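(* Let $n\ge 1$, let $\pi\in S_n$ be any permutation and let $a_1,\dots,a_n\in\mathbb{C}$ be arbitrary. Then the evolution algebra of permutations $E_{n,\pi}(a_1,a_2,\dots,a_n)$ is isomorphic to a direct sum of algebras of the form $E_p$ and $EN_k$; that is, there exist integers $s,r\ge 0$ and positive integers $p_1,\dots,p_s,k_1,\dots,k_r$ such that $$E_{n,\pi}(a_1,a_2,\dots,a_n)\cong E_{p_1}\oplus E_{p_2}\oplus\dots\oplus E_{p_s}\oplus EN_{k_1}\oplus EN_{k_2}\oplus\dots\oplus EN_{k_r}.$$
   Context: All algebras are complex, finite-dimensional and not necessarily associative; omitted products of basis elements are zero. For $\pi\in S_n$ and $a_1,\dots,a_n\in\mathbb{C}$, the evolution algebra of permutations $E_{n,\pi}(a_1,\dots,a_n)$ is the algebra with basis $\{e_1,\dots,e_n\}$ and products $e_i\cdot e_i=a_ie_{\pi(i)}$ for $1\le i\le n$ and $e_i\cdot e_j=0$ for $i\ne j$. For $m\ge 1$, $E_m$ is the algebra with basis $e_1,\dots,e_m$ and products $e_i\cdot e_i=e_{i+1}$ $(1\le i\le m-1)$, $e_m\cdot e_m=e_1$, $e_i\cdot e_j=0$ $(i\neq j)$. For $m\ge1$, $EN_m$ is the algebra with basis $e_1,\dots,e_m$ and products $e_i\cdot e_i=e_{i+1}$ $(1\le i\le m-1)$, $e_m\cdot e_m=0$, $e_i\cdot e_j=0$ $(i\ne j)$. In a direct sum of algebras, products of elements from different summands are zero. *)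

theory Defs
  imports Complex_Main "HOL-Combinatorics.Permutations"
begin

text \<open>Not necessarily associative complex algebras, given by an explicit carrier set and operations,
  so that the dimension can be an arbitrary natural number inside a formula.\<close>

record 'a complex_alg =
  alg_carrier :: "'a set"
  alg_add :: "'a \<Rightarrow> 'a \<Rightarrow> 'a"
  alg_scale :: "complex \<Rightarrow> 'a \<Rightarrow> 'a"
  alg_mult :: "'a \<Rightarrow> 'a \<Rightarrow> 'a"

definition alg_isomorphism :: "('a \<Rightarrow> 'b) \<Rightarrow> 'a complex_alg \<Rightarrow> 'b complex_alg \<Rightarrow> bool" where
  "alg_isomorphism f A B \<longleftrightarrow>
     bij_betw f (alg_carrier A) (alg_carrier B) \<and>
     (\<forall>x\<in>alg_carrier A. \<forall>y\<in>alg_carrier A. f (alg_add A x y) = alg_add B (f x) (f y)) \<and>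
     (\<forall>c. \<forall>x\<in>alg_carrier A. f (alg_scale A c x) = alg_scale B c (f x)) \<and>
     (\<forall>x\<in>alg_carrier A. \<forall>y\<in>alg_carrier A. f (alg_mult A x y) = alg_mult B (f x) (f y))"

definition alg_isomorphic :: "'a complex_alg \<Rightarrow> 'b complex_alg \<Rightarrow> bool" where
  "alg_isomorphic A B \<longleftrightarrow> (\<exists>f. alg_isomorphism f A B)"

text \<open>The coordinate vector of \<open>e\<^sub>i\<close>.\<close>

definition basis_vec :: "nat \<Rightarrow> nat \<Rightarrow> complex" where
  "basis_vec i = (\<lambda>k. if k = i then 1 else 0)"

text \<open>The algebra with basis \<open>e\<^sub>1, \<dots>, e\<^sub>n\<close> and \<open>e\<^sub>i \<cdot> e\<^sub>j = t i j\<close>, extended bilinearly. A vector is its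
  coordinate function, which vanishes outside \<open>{1..n}\<close>; the table \<open>t\<close> is meant to have values of
  this kind for \<open>i, j \<in> {1..n}\<close>, and its other values are irrelevant.\<close>

definition table_alg :: "nat \<Rightarrow> (nat \<Rightarrow> nat \<Rightarrow> nat \<Rightarrow> complex) \<Rightarrow> (nat \<Rightarrow> complex) complex_alg" where
  "table_alg n t =
     \<lparr> alg_carrier = {x. \<forall>k. k \<notin> {1..n} \<longrightarrow> x k = 0},
       alg_add = (\<lambda>x y k. x k + y k),
       alg_scale = (\<lambda>c x k. c * x k),
       alg_mult = (\<lambda>x y k. \<Sum>i\<in>{1..n}. \<Sum>j\<in>{1..n}. x i * y j * t i j k) \<rparr>"

definition perm_evolution_alg ::
    "nat \<Rightarrow> (nat \<Rightarrow> nat) \<Rightarrow> (nat \<Rightarrow> complex) \<Rightarrow> (nat \<Rightarrow> complex) complex_alg" where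
  "perm_evolution_alg n \<pi> a =
     table_alg n (\<lambda>i j. if i = j then (\<lambda>k. a i * basis_vec (\<pi> i) k) else (\<lambda>k. 0))"

definition E_alg :: "nat \<Rightarrow> (nat \<Rightarrow> complex) complex_alg" where
  "E_alg m =
     table_alg m (\<lambda>i j. if i = j then (if i < m then basis_vec (i + 1) else basis_vec 1)
                        else (\<lambda>k. 0))"

definition EN_alg :: "nat \<Rightarrow> (nat \<Rightarrow> complex) complex_alg" where
  "EN_alg m =
     table_alg m (\<lambda>i j. if i = j \<and> i < m then basis_vec (i + 1) else (\<lambda>k. 0))"

text \<open>The (external) direct sum of a list of algebras: tuples with componentwise operations, so that
  products of elements from different summands are zero. The summands share an element type but
  may have different carriers.\<close>

definition direct_sum_alg :: "'a complex_alg list \<Rightarrow> 'a list complex_alg" where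
  "direct_sum_alg As =
     \<lparr> alg_carrier = {xs. length xs = length As \<and> (\<forall>i<length As. xs ! i \<in> alg_carrier (As ! i))},
       alg_add = (\<lambda>xs ys. map (\<lambda>i. alg_add (As ! i) (xs ! i) (ys ! i)) [0..<length As]),
       alg_scale = (\<lambda>c xs. map (\<lambda>i. alg_scale (As ! i) c (xs ! i)) [0..<length As]),
       alg_mult = (\<lambda>xs ys. map (\<lambda>i. alg_mult (As ! i) (xs ! i) (ys ! i)) [0..<length As]) \<rparr>"

lemma table_alg_mult_basis:
  assumes "i \<in> {1..n}" "j \<in> {1..n}"
  shows "alg_mult (table_alg n t) (basis_vec i) (basis_vec j) = t i j"
proof
  fix k
  have "alg_mult (table_alg n t) (basis_vec i) (basis_vec j) k =
      (\<Sum>i'\<in>{1..n}. \<Sum>j'\<in>{1..n}. if j' = j then (if i' = i then t i' j' k else 0) else 0)"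
    unfolding table_alg_def complex_alg.simps basis_vec_def by (intro sum.cong refl) simp
  also have "\<dots> = (\<Sum>i'\<in>{1..n}. if i' = i then t i' j k else 0)"
    using assms(2) by (intro sum.cong refl) (subst sum.delta, auto)
  also have "\<dots> = t i j k"
    using assms(1) by (subst sum.delta) auto
  finally show "alg_mult (table_alg n t) (basis_vec i) (basis_vec j) k = t i j k" .
qed

lemma perm_evolution_alg_mult_basis:
  assumes "i \<in> {1..n}" "j \<in> {1..n}"
  shows "alg_mult (perm_evolution_alg n \<pi> a) (basis_vec i) (basis_vec j) =
    (if i = j then alg_scale (perm_evolution_alg n \<pi> a) (a i) (basis_vec (\<pi> i)) else (\<lambda>k. 0))"
  unfolding perm_evolution_alg_def table_alg_mult_basis[OF assms] by (simp add: table_alg_def)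

end

theory Submission imports Defs begin

text \<open>
  Picture the algebra as a weighted graph with an arrow \<open>i \<rightarrow> \<pi> i\<close> of weight \<open>a i\<close> for every \<open>i\<close> and
  delete the arrows of weight \<open>0\<close>. What remains is a partial injection of a finite set, and its
  graph is a disjoint union of directed cycles and directed paths (lemma
  \<open>cycle_path_partition_exists\<close>). A cycle with \<open>p\<close> vertices will give a summand \<open>E\<^sub>p\<close> and a path with
  \<open>k\<close> vertices a summand \<open>EN\<^sub>k\<close>; products across components vanish anyway, because distinct basis
  vectors multiply to \<open>0\<close>.

  It remains to turn the nonzero weights into \<open>1\<close> by rescaling the basis. In terms of coordinates,
  multiplying the \<open>i\<close>-th coordinate by \<open>d i \<noteq> 0\<close> makes the weight of the arrow at \<open>i\<close> equal to
  \<open>d (\<pi> i) * a i / (d i)\<^sup>2\<close>, so the requirement is \<open>d (\<pi> i) = (d i)\<^sup>2 / a i\<close> along every arrow. On a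
  path this is a recursion with free initial value. On a cycle of length \<open>m\<close> the recursion returns
  to an initial value \<open>t\<close> as \<open>t ^ 2 ^ m * c\<close> for some constant \<open>c \<noteq> 0\<close>; it closes up when
  \<open>t ^ (2 ^ m - 1) = 1 / c\<close>, which is solvable since \<open>2 ^ m - 1 > 0\<close> and the scalars are complex
  (lemma \<open>cyclic_rescaling_exists\<close>).

  Both kinds of summand are treated at once by viewing \<open>EN\<^sub>k\<close> as a cycle whose closing arrow has weight
  \<open>0\<close>. That relabelling and rescaling the basis in this way is an isomorphism onto the direct sum is
  lemma \<open>alg_isomorphic_direct_sum_blocks\<close>.
\<close>

section \<open>Permutation evolution algebras in coordinates\<close>

text \<open>
  Basis vectors are numbered from \<open>1\<close>, so the cyclic shift sends the last index back to \<open>1\<close>.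
\<close>

definition rot :: "nat \<Rightarrow> nat \<Rightarrow> nat" where
  "rot m i = (if i < m then Suc i else 1)"

lemma bij_betw_rot: "bij_betw (rot m) {1..m} {1..m}"
proof -
  have "inj_on (rot m) {1..m}"
    by (auto simp: inj_on_def rot_def split: if_splits)
  moreover have "rot m ` {1..m} \<subseteq> {1..m}"
    by (auto simp: rot_def)
  ultimately show ?thesis
    by (simp add: bij_betw_def endo_inj_surj)
qed

text \<open>
  The summands are themselves permutation evolution algebras over the same cyclic shift. They differ
  only in the weight of the closing arrow from \<open>m\<close> to \<open>1\<close>.
\<close>

lemma E_alg_eq: "E_alg m = perm_evolution_alg m (rot m) (\<lambda>_. 1)"
  unfolding E_alg_def perm_evolution_alg_def
  by (rule arg_cong[where f = "table_alg m"]) (auto simp: fun_eq_iff rot_def)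

lemma EN_alg_eq: "EN_alg m = perm_evolution_alg m (rot m) (\<lambda>i. if i < m then 1 else 0)"
  unfolding EN_alg_def perm_evolution_alg_def
  by (rule arg_cong[where f = "table_alg m"]) (auto simp: fun_eq_iff rot_def)

lemma table_alg_cong:
  assumes "\<And>i j. i \<in> {1..n} \<Longrightarrow> j \<in> {1..n} \<Longrightarrow> t i j = u i j"
  shows "table_alg n t = table_alg n u"
proof -
  have "(\<Sum>i\<in>{1..n}. \<Sum>j\<in>{1..n}. x i * y j * t i j k) =
      (\<Sum>i\<in>{1..n}. \<Sum>j\<in>{1..n}. x i * y j * u i j k)" for x y :: "nat \<Rightarrow> complex" and k
    by (intro sum.cong refl) (simp add: assms)
  then show ?thesis by (simp add: table_alg_def)
qed

lemma perm_evolution_alg_cong: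
  assumes "\<And>i. i \<in> {1..n} \<Longrightarrow> a i = b i"
  shows "perm_evolution_alg n \<pi> a = perm_evolution_alg n \<pi> b"
  unfolding perm_evolution_alg_def by (rule table_alg_cong) (auto simp: assms)

lemma perm_evolution_alg_simps [simp]:
  "alg_carrier (perm_evolution_alg n \<pi> a) = {x. \<forall>k. k \<notin> {1..n} \<longrightarrow> x k = 0}"
  "alg_add (perm_evolution_alg n \<pi> a) = (\<lambda>x y k. x k + y k)"
  "alg_scale (perm_evolution_alg n \<pi> a) = (\<lambda>c x k. c * x k)"
  by (simp_all add: perm_evolution_alg_def table_alg_def)

lemma perm_evolution_alg_mult:
  "alg_mult (perm_evolution_alg n \<pi> a) x y k =
     (\<Sum>i\<in>{1..n}. if \<pi> i = k then a i * (x i * y i) else 0)"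
proof -
  have "alg_mult (perm_evolution_alg n \<pi> a) x y k =
      (\<Sum>i\<in>{1..n}. \<Sum>j\<in>{1..n}. if j = i then (if \<pi> i = k then a i * (x i * y i) else 0) else 0)"
    unfolding perm_evolution_alg_def table_alg_def complex_alg.simps basis_vec_def
    by (intro sum.cong refl) auto
  then show ?thesis by simp
qed

text \<open>
  Since \<open>\<pi>\<close> is injective, only \<open>e\<^sub>i \<cdot> e\<^sub>i\<close> contributes to the coordinate at \<open>\<pi> i\<close>.
\<close>

lemma perm_evolution_alg_mult_image:
  assumes "inj_on \<pi> {1..n}" "i \<in> {1..n}"
  shows "alg_mult (perm_evolution_alg n \<pi> a) x y (\<pi> i) = a i * (x i * y i)"
proof -
  have "alg_mult (perm_evolution_alg n \<pi> a) x y (\<pi> i) =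
      (\<Sum>j\<in>{1..n}. if j = i then a j * (x j * y j) else 0)"
    unfolding perm_evolution_alg_mult
    using assms by (intro sum.cong refl if_cong) (auto dest: inj_onD)
  then show ?thesis using assms(2) by simp
qed

lemma perm_evolution_alg_mult_outside:
  assumes "\<pi> ` {1..n} \<subseteq> {1..n}" "k \<notin> {1..n}"
  shows "alg_mult (perm_evolution_alg n \<pi> a) x y k = 0"
  unfolding perm_evolution_alg_mult using assms by (intro sum.neutral) auto

section \<open>Isomorphisms from rescaled and relabelled bases\<close>

text \<open>
  The blocks \<open>b\<close> are the components of the arrow graph: \<open>g b j\<close> is the vertex of \<open>{1..n}\<close> at position
  \<open>j\<close> of block \<open>b\<close>, and the isomorphism multiplies its coordinate by \<open>d b j\<close>. The equation \<open>weight\<close>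
  says that the arrow leaving position \<open>j\<close> acquires weight \<open>\<beta> b j\<close>. Agreement of \<open>\<rho> b\<close> with \<open>\<pi>\<close> is
  demanded only for arrows of nonzero weight, so that the end of a path may be redirected to its
  start.
\<close>

lemma alg_isomorphic_direct_sum_blocks:
  fixes m :: "'b \<Rightarrow> nat" and d :: "'b \<Rightarrow> nat \<Rightarrow> complex"
  assumes \<pi>: "bij_betw \<pi> {1..n} {1..n}"
    and B: "distinct B"
    and \<rho>: "\<And>b. b \<in> set B \<Longrightarrow> bij_betw (\<rho> b) {1..m b} {1..m b}"
    and g: "bij_betw (\<lambda>(b, j). g b j) (SIGMA b:set B. {1..m b}) {1..n}"
    and d: "\<And>b j. d b j \<noteq> 0"
    and weight: "\<And>b j. b \<in> set B \<Longrightarrow> j \<in> {1..m b} \<Longrightarrow>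
      d b (\<rho> b j) * a (g b j) = \<beta> b j * (d b j)\<^sup>2"
    and arrow: "\<And>b j. b \<in> set B \<Longrightarrow> j \<in> {1..m b} \<Longrightarrow> a (g b j) \<noteq> 0 \<Longrightarrow>
      g b (\<rho> b j) = \<pi> (g b j)"
  shows "alg_isomorphic (perm_evolution_alg n \<pi> a)
    (direct_sum_alg (map (\<lambda>b. perm_evolution_alg (m b) (\<rho> b) (\<beta> b)) B))"
proof -
  let ?A = "perm_evolution_alg n \<pi> a"
  let ?C = "\<lambda>b. perm_evolution_alg (m b) (\<rho> b) (\<beta> b)"
  let ?D = "direct_sum_alg (map ?C B)"
  define \<phi> where "\<phi> = (\<lambda>b x k. if k \<in> {1..m b} then d b k * x (g b k) else (0::complex))"
  define f where "f = (\<lambda>x. map (\<lambda>b. \<phi> b x) B)"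
  have g_in: "g b j \<in> {1..n}" if "b \<in> set B" "j \<in> {1..m b}" for b j
    using bij_betwE[OF g] that by auto
  have g_inj: "b = b' \<and> j = j'"
    if "b \<in> set B" "j \<in> {1..m b}" "b' \<in> set B" "j' \<in> {1..m b'}" "g b j = g b' j'" for b j b' j'
    using inj_onD[OF bij_betw_imp_inj_on[OF g], of "(b, j)" "(b', j')"] that by auto
  have g_surj: "\<exists>b\<in>set B. \<exists>j\<in>{1..m b}. i = g b j" if "i \<in> {1..n}" for i
    using that unfolding bij_betw_imp_surj_on[OF g, symmetric] by auto
  have \<pi>_inj: "inj_on \<pi> {1..n}" and \<pi>_img: "\<pi> ` {1..n} = {1..n}"
    using \<pi> by (auto simp: bij_betw_def)
  have mult: "\<phi> b (alg_mult ?A x y) = alg_mult (?C b) (\<phi> b x) (\<phi> b y)"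
    if b: "b \<in> set B" for b x y
  proof
    fix k
    have \<rho>_inj: "inj_on (\<rho> b) {1..m b}" and \<rho>_img: "\<rho> b ` {1..m b} = {1..m b}"
      using \<rho>[OF b] by (auto simp: bij_betw_def)
    show "\<phi> b (alg_mult ?A x y) k = alg_mult (?C b) (\<phi> b x) (\<phi> b y) k"
    proof (cases "k \<in> {1..m b}")
      case False
      then show ?thesis
        using perm_evolution_alg_mult_outside[of "\<rho> b" "m b" k] \<rho>_img by (auto simp: \<phi>_def)
    next
      case True
      then obtain j where j: "j \<in> {1..m b}" and k: "k = \<rho> b j"
        using \<rho>_img by blast
      have rhs: "alg_mult (?C b) (\<phi> b x) (\<phi> b y) k = \<beta> b j * (d b j)\<^sup>2 * (x (g b j) * y (g b j))"
        unfolding k perm_evolution_alg_mult_image[OF \<rho>_inj j]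
        using j by (simp add: \<phi>_def power2_eq_square)
      show ?thesis
      proof (cases "a (g b j) = 0")
        case False
        have "alg_mult ?A x y (g b k) = a (g b j) * (x (g b j) * y (g b j))"
          unfolding k arrow[OF b j False]
          by (rule perm_evolution_alg_mult_image[OF \<pi>_inj g_in[OF b j]])
        then show ?thesis
          unfolding rhs weight[OF b j, symmetric] using True by (simp add: \<phi>_def k)
      next
        case zero: True
        \<comment> \<open>An arrow of nonzero weight into this position would start at the same position by
          injectivity, so none does.\<close>
        obtain i where i: "i \<in> {1..n}" "g b k = \<pi> i"
          using \<pi>_img g_in[OF b True] by (metis imageE)
        obtain b' j' where b': "b' \<in> set B" "j' \<in> {1..m b'}" "i = g b' j'"
          using g_surj[OF i(1)] by blast
        have "a i = 0"
        proof (rule ccontr)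
          assume nz: "a i \<noteq> 0"
          have "\<rho> b' j' \<in> {1..m b'}" using bij_betwE[OF \<rho>[OF b'(1)]] b'(2) by blast
          moreover have "g b' (\<rho> b' j') = g b k"
            using arrow[OF b'(1,2)] nz b'(3) i(2) by simp
          ultimately have "b' = b" "\<rho> b' j' = k"
            using g_inj b b'(1) True by metis+
          then have "j' = j" using inj_onD[OF \<rho>_inj] j b'(2) k by metis
          then show False using zero nz b'(3) \<open>b' = b\<close> by simp
        qed
        then have "alg_mult ?A x y (g b k) = 0"
          unfolding i(2) perm_evolution_alg_mult_image[OF \<pi>_inj i(1)] by simp
        then show ?thesis
          unfolding rhs weight[OF b j, symmetric] using zero by (simp add: \<phi>_def)
      qed
    qed
  qed
  have inj: "inj_on f (alg_carrier ?A)"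
  proof (rule inj_onI, rule ext)
    fix x y i
    assume x: "x \<in> alg_carrier ?A" and y: "y \<in> alg_carrier ?A" and eq: "f x = f y"
    show "x i = y i"
    proof (cases "i \<in> {1..n}")
      case True
      then obtain b j where bj: "b \<in> set B" "j \<in> {1..m b}" "i = g b j"
        using g_surj by blast
      have "\<phi> b x = \<phi> b y" using eq bj(1) by (simp add: f_def)
      then have "\<phi> b x j = \<phi> b y j" by simp
      then show ?thesis using bj d[of b j] by (simp add: \<phi>_def)
    qed (use x y in auto)
  qed
  have into: "f x \<in> alg_carrier ?D" for x
    by (auto simp: f_def \<phi>_def direct_sum_alg_def)
  have surj: "\<exists>x\<in>alg_carrier ?A. f x = ys" if ys: "ys \<in> alg_carrier ?D" for ys
  proof -
    have len: "length ys = length B" and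
      ys0: "\<And>q k. q < length B \<Longrightarrow> k \<notin> {1..m (B ! q)} \<Longrightarrow> (ys ! q) k = 0"
      using ys by (auto simp: direct_sum_alg_def)
    define G where "G = inv_into (SIGMA b:set B. {1..m b}) (\<lambda>(b, j). g b j)"
    define Y where "Y b = the (map_of (zip B ys) b)" for b
    have Y: "Y (B ! q) = ys ! q" if "q < length B" for q
      using map_of_zip_nth[OF len[symmetric] B, of q] that by (simp add: Y_def len)
    define x where "x i = (if i \<in> {1..n} then case G i of (b, j) \<Rightarrow> Y b j / d b j else 0)" for i
    have G: "G (g b j) = (b, j)" if "b \<in> set B" "j \<in> {1..m b}" for b j
      using inv_into_f_f[OF bij_betw_imp_inj_on[OF g], of "(b, j)"] that by (simp add: G_def)
    have "f x = ys"
    proof (rule nth_equalityI)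
      fix q assume "q < length (f x)"
      then have q: "q < length B" by (simp add: f_def)
      have "\<phi> (B ! q) x k = (ys ! q) k" for k
        using G[of "B ! q" k] g_in[of "B ! q" k] ys0[OF q, of k] Y[OF q] q d[of "B ! q" k]
        by (auto simp: \<phi>_def x_def)
      then show "f x ! q = ys ! q" using q by (auto simp: f_def)
    qed (simp add: f_def len)
    moreover have "x \<in> alg_carrier ?A" by (simp add: x_def)
    ultimately show ?thesis by blast
  qed
  have "bij_betw f (alg_carrier ?A) (alg_carrier ?D)"
    unfolding bij_betw_def using inj into surj by blast
  moreover have "f (alg_add ?A x y) = alg_add ?D (f x) (f y)" for x y
    by (rule nth_equalityI) (auto simp: f_def \<phi>_def direct_sum_alg_def distrib_left)
  moreover have "f (alg_scale ?A c x) = alg_scale ?D c (f x)" for c x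
    by (rule nth_equalityI) (auto simp: f_def \<phi>_def direct_sum_alg_def)
  moreover have "f (alg_mult ?A x y) = alg_mult ?D (f x) (f y)" for x y
    by (rule nth_equalityI) (simp_all add: f_def direct_sum_alg_def mult)
  ultimately show ?thesis
    unfolding alg_isomorphic_def alg_isomorphism_def by blast
qed

section \<open>Normalising the weights\<close>

lemma complex_root_exists:
  fixes c :: complex
  assumes "0 < k"
  shows "\<exists>z. z ^ k = c"
proof (cases "c = 0")
  case False
  have "{z. z ^ k = c} \<noteq> {}"
    using card_nth_roots[OF False assms] assms by (metis card.empty less_numeral_extra(3))
  then show ?thesis by blast
qed (use assms in auto)

text \<open>
  The recursion \<open>z \<mapsto> z\<^sup>2 / \<alpha> j\<close> around the cycle scales its \<open>j\<close>-th value by \<open>t ^ 2 ^ j\<close> when the initial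
  value \<open>1\<close> is replaced by \<open>t\<close>. Hence closing the cycle is a single equation for \<open>t ^ (2 ^ m - 1)\<close>.
\<close>

lemma cyclic_rescaling_exists:
  fixes \<alpha> :: "nat \<Rightarrow> complex"
  assumes \<alpha>: "\<And>j. \<alpha> j \<noteq> 0" and m: "m \<ge> 1"
  shows "\<exists>w. (\<forall>j. w j \<noteq> 0) \<and> (\<forall>j\<in>{1..m}. w (rot m j) * \<alpha> j = (w j)\<^sup>2)"
proof -
  define v where "v t = rec_nat t (\<lambda>j z. z\<^sup>2 / \<alpha> (Suc j))" for t
  have v0: "v t 0 = t" and vS: "v t (Suc j) = (v t j)\<^sup>2 / \<alpha> (Suc j)" for t j
    by (simp_all add: v_def)
  have nz: "v t j \<noteq> 0" if "t \<noteq> 0" for t j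
    using that by (induction j) (simp_all add: v0 vS \<alpha>)
  have hom: "v t j = t ^ (2 ^ j) * v 1 j" for t j
    by (induction j) (simp_all add: v0 vS power_mult_distrib power_mult[symmetric] mult.commute)
  have pos: "0 < (2::nat) ^ m - 1"
    using one_less_power[of "2::nat" m] m by simp
  then obtain t where t: "t ^ (2 ^ m - 1) = inverse (v 1 m)"
    using complex_root_exists by blast
  have t0: "t \<noteq> 0"
  proof
    assume "t = 0"
    then show False using t nz[of 1 m] pos by (simp add: power_0_left)
  qed
  have "t ^ (2 ^ m) = t * t ^ (2 ^ m - 1)"
    using power_minus_mult[of "2 ^ m" t] by (simp add: mult.commute)
  then have close: "v t m = t"
    using hom[of t m] t nz[of 1 m] by simp
  define w where "w j = v t (j - 1)" for j
  have "w (rot m j) * \<alpha> j = (w j)\<^sup>2" if j: "j \<in> {1..m}" for j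
  proof -
    have "w (rot m j) = v t j"
      using j close by (auto simp: w_def rot_def v0)
    also have "\<dots> = (w j)\<^sup>2 / \<alpha> j"
      using j vS[of t "j - 1"] by (simp add: w_def)
    finally show ?thesis using \<alpha> by simp
  qed
  then show ?thesis using nz[OF t0] by (intro exI[of _ w]) (simp add: w_def)
qed

section \<open>Decomposing a partial permutation into cycles and paths\<close>

text \<open>
  A component is written as the list of its vertices in the order of the arrows; a cycle is cut open
  at an arbitrary vertex. The lists in \<open>\<C>\<close> are the cycles and those in \<open>\<P>\<close> the paths. The arrow that
  \<open>f\<close> has at the last vertex of a path is regarded as deleted.
\<close>

definition cycle_path_partition ::
    "('a \<Rightarrow> 'a) \<Rightarrow> 'a set \<Rightarrow> 'a list set \<Rightarrow> 'a list set \<Rightarrow> bool" where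
  "cycle_path_partition f S \<C> \<P> \<longleftrightarrow>
     finite \<C> \<and> finite \<P> \<and> \<C> \<inter> \<P> = {} \<and>
     (\<forall>xs\<in>\<C> \<union> \<P>. xs \<noteq> [] \<and> distinct xs \<and> successively (\<lambda>i j. j = f i) xs) \<and>
     (\<forall>xs\<in>\<C> \<union> \<P>. \<forall>ys\<in>\<C> \<union> \<P>. xs \<noteq> ys \<longrightarrow> set xs \<inter> set ys = {}) \<and>
     (\<Union>xs\<in>\<C> \<union> \<P>. set xs) = S \<and>
     (\<forall>xs\<in>\<C>. f (last xs) = hd xs)"

lemma cycle_path_partitionD:
  assumes "cycle_path_partition f S \<C> \<P>"
  shows "finite \<C>" "finite \<P>" "\<C> \<inter> \<P> = {}"
    and "\<And>xs. xs \<in> \<C> \<union> \<P> \<Longrightarrow> xs \<noteq> [] \<and> distinct xs \<and> successively (\<lambda>i j. j = f i) xs"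
    and "\<And>xs ys i. xs \<in> \<C> \<union> \<P> \<Longrightarrow> ys \<in> \<C> \<union> \<P> \<Longrightarrow> i \<in> set xs \<Longrightarrow> i \<in> set ys \<Longrightarrow> xs = ys"
    and "(\<Union>xs\<in>\<C> \<union> \<P>. set xs) = S"
    and "\<And>xs. xs \<in> \<C> \<Longrightarrow> f (last xs) = hd xs"
  using assms unfolding cycle_path_partition_def by blast+

text \<open>
  Here \<open>D\<close> is the set of vertices whose arrow is kept. Draw these arrows one at a time, starting from
  isolated vertices. By injectivity of \<open>f\<close>, a new arrow runs from the end of a path to the start of
  a path: if these are the same path it becomes a cycle, otherwise the two paths are joined.
\<close>

lemma cycle_path_partition_exists:
  assumes "finite S" "inj_on f S" "f ` S \<subseteq> S" "D \<subseteq> S"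
  shows "\<exists>\<C> \<P>. cycle_path_partition f S \<C> \<P> \<and> last ` \<P> = S - D"
proof -
  have "finite D" using assms(1,4) by (rule rev_finite_subset)
  then show ?thesis using assms(4)
  proof (induction D)
    case empty
    have "cycle_path_partition f S {} ((\<lambda>x. [x]) ` S)"
      using assms(1) by (auto simp: cycle_path_partition_def)
    moreover have "last ` (\<lambda>x. [x]) ` S = S - {}" by (simp add: image_image)
    ultimately show ?case by blast
  next
    case (insert z D)
    then obtain \<C> \<P> where P: "cycle_path_partition f S \<C> \<P>" and lst: "last ` \<P> = S - D"
      by auto
    note fin = cycle_path_partitionD(1,2)[OF P] and CP = cycle_path_partitionD(3)[OF P]
      and lists = cycle_path_partitionD(4)[OF P] and disj = cycle_path_partitionD(5)[OF P]
      and cover = cycle_path_partitionD(6)[OF P] and closed = cycle_path_partitionD(7)[OF P]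
    have zS: "z \<in> S" and zD: "z \<notin> D" using insert by auto
    then obtain A where A: "A \<in> \<P>" "last A = z" using lst by (metis DiffI imageE)
    have zA: "z \<in> set A" using A lists[of A] by auto
    \<comment> \<open>The only possible predecessor of the target of the new arrow is its source, which has no
      arrow yet; hence the target is the start of a path.\<close>
    obtain B where B: "B \<in> \<C> \<union> \<P>" "f z \<in> set B"
      using cover zS assms(3) by blast
    obtain q where q: "q < length B" "B ! q = f z" using B(2) by (metis in_set_conv_nth)
    have pred: "i = z" if "i \<in> set B" "f i = f z" for i
      using inj_onD[OF assms(2)] that B(1) cover zS by blast
    have q0: "q = 0"
    proof (rule ccontr)
      assume "q \<noteq> 0"
      then obtain r where r: "q = Suc r" by (cases q) auto
      have "B ! q = f (B ! r)"
        using lists[OF B(1)] q(1) by (simp add: r successively_conv_nth)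
      then have "B ! r = z" using pred q r by simp
      moreover have "B = A"
        using disj[of B A z] B(1) A(1) zA q(1) r \<open>B ! r = z\<close> by (metis Suc_lessD UnI2 nth_mem)
      ultimately have "B ! r = B ! (length B - 1)"
        using A(2) lists[OF B(1)] by (simp add: last_conv_nth)
      then show False
        using q(1) r lists[OF B(1)] nth_eq_iff_index_eq[of B r "length B - 1"] by simp
    qed
    then have hdB: "hd B = f z" using q lists[OF B(1)] by (simp add: hd_conv_nth)
    have BP: "B \<in> \<P>"
    proof (rule ccontr)
      assume "B \<notin> \<P>"
      then have BC: "B \<in> \<C>" using B(1) by blast
      then have "last B = z" using closed hdB lists[OF B(1)] pred[of "last B"] by simp
      then show False using disj[of B A z] A(1) B(1) zA BC CP lists[OF B(1)] by auto
    qed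
    have last_inj: "xs = ys" if "xs \<in> \<P>" "ys \<in> \<P>" "last xs = last ys" for xs ys
      using disj[of xs ys "last xs"] lists that by (metis UnI2 last_in_set)
    show ?case
    proof (cases "A = B")
      case True
      have "cycle_path_partition f S (insert A \<C>) (\<P> - {A})"
        unfolding cycle_path_partition_def
      proof (intro conjI)
        have "insert A \<C> \<union> (\<P> - {A}) = \<C> \<union> \<P>" using A(1) by blast
        then show "\<forall>xs\<in>insert A \<C> \<union> (\<P> - {A}). xs \<noteq> [] \<and> distinct xs \<and>
              successively (\<lambda>i j. j = f i) xs"
          "\<forall>xs\<in>insert A \<C> \<union> (\<P> - {A}). \<forall>ys\<in>insert A \<C> \<union> (\<P> - {A}).
              xs \<noteq> ys \<longrightarrow> set xs \<inter> set ys = {}"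
          "(\<Union>xs\<in>insert A \<C> \<union> (\<P> - {A}). set xs) = S"
          using lists disj cover by (simp_all, blast+)
      qed (use fin CP closed hdB A True in auto)
      moreover have "last ` (\<P> - {A}) = S - insert z D"
        using lst A last_inj by blast
      ultimately show ?thesis by blast
    next
      case False
      let ?\<P> = "insert (A @ B) (\<P> - {A, B})"
      have AB: "set A \<inter> set B = {}" using disj False A(1) BP by blast
      have new: "A @ B \<notin> \<C>"
        using disj[of "A @ B" A z] zA A(1) CP by auto
      have join: "distinct (A @ B)" "successively (\<lambda>i j. j = f i) (A @ B)"
        using lists[of A] lists[of B] A BP AB hdB by (auto simp: successively_append_iff)
      have "cycle_path_partition f S \<C> ?\<P>"
        unfolding cycle_path_partition_def
      proof (intro conjI)
        show "\<forall>xs\<in>\<C> \<union> ?\<P>. xs \<noteq> [] \<and> distinct xs \<and> successively (\<lambda>i j. j = f i) xs"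
          using lists join zA by auto
        have "set xs \<inter> set (A @ B) = {}" if "xs \<in> \<C> \<union> (\<P> - {A, B})" for xs
          using that disj[of xs A] disj[of xs B] A(1) BP CP by fastforce
        then show "\<forall>xs\<in>\<C> \<union> ?\<P>. \<forall>ys\<in>\<C> \<union> ?\<P>. xs \<noteq> ys \<longrightarrow> set xs \<inter> set ys = {}"
          using disj by blast
        show "(\<Union>xs\<in>\<C> \<union> ?\<P>. set xs) = S"
          using cover A(1) BP by auto
      qed (use fin CP closed new in auto)
      moreover have "last ` ?\<P> = S - insert z D"
      proof -
        have "last (A @ B) = last B" using lists[of B] BP by simp
        then have "last ` ?\<P> = last ` (\<P> - {A})" using BP False by auto
        also have "\<dots> = S - insert z D" using lst A last_inj by blast
        finally show ?thesis .
      qed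
      ultimately show ?thesis by blast
    qed
  qed
qed

lemma bij_betw_cycle_path_partition:
  assumes "cycle_path_partition f S \<C> \<P>"
  shows "bij_betw (\<lambda>(xs, j). xs ! (j - 1)) (SIGMA xs:\<C> \<union> \<P>. {1..length xs}) S"
proof -
  note lists = cycle_path_partitionD(4)[OF assms] and disj = cycle_path_partitionD(5)[OF assms]
    and cover = cycle_path_partitionD(6)[OF assms]
  have pos: "(\<lambda>j. xs ! (j - 1)) ` {1..length xs} = set xs" for xs :: "'a list"
  proof -
    have "(\<lambda>j. xs ! (j - 1)) ` Suc ` {0..<length xs} = set xs"
      unfolding image_image by (auto simp: set_conv_nth)
    then show ?thesis by (simp add: image_Suc_atLeastLessThan atLeastLessThanSuc_atLeastAtMost)
  qed
  have "(\<lambda>(xs, j). xs ! (j - 1)) ` (SIGMA xs:\<C> \<union> \<P>. {1..length xs}) = S"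
    unfolding cover[symmetric] pos[symmetric] by force
  moreover have "inj_on (\<lambda>(xs, j). xs ! (j - 1)) (SIGMA xs:\<C> \<union> \<P>. {1..length xs})"
  proof (intro inj_onI, clarify)
    fix xs ys i j
    assume xs: "xs \<in> \<C> \<union> \<P>" and ys: "ys \<in> \<C> \<union> \<P>" and i: "i \<in> {1..length xs}"
      and j: "j \<in> {1..length ys}" and eq: "xs ! (i - 1) = ys ! (j - 1)"
    have "xs = ys" using disj[OF xs ys] pos i j eq by (metis imageI)
    moreover from this have "i - 1 = j - 1"
      using eq i j lists[OF xs] nth_eq_iff_index_eq[of xs "i - 1" "j - 1"] by auto
    ultimately show "xs = ys \<and> i = j" using i j by auto
  qed
  ultimately show ?thesis by (simp add: bij_betw_def)
qed

theorem theorem3p9: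
  fixes n :: nat and \<pi> :: "nat \<Rightarrow> nat" and a :: "nat \<Rightarrow> complex"
  assumes "n \<ge> 1" and "\<pi> permutes {1..n}"
  shows "\<exists>ps ks :: nat list.
    (\<forall>p\<in>set ps. p \<ge> 1) \<and> (\<forall>k\<in>set ks. k \<ge> 1) \<and>
    alg_isomorphic (perm_evolution_alg n \<pi> a) (direct_sum_alg (map E_alg ps @ map EN_alg ks))"
proof -
  have \<pi>: "bij_betw \<pi> {1..n} {1..n}" using assms(2) by (rule permutes_imp_bij)
  then have "inj_on \<pi> {1..n}" "\<pi> ` {1..n} \<subseteq> {1..n}" by (auto simp: bij_betw_def)
  then obtain \<C> \<P> where P: "cycle_path_partition \<pi> {1..n} \<C> \<P>"
    and lst: "last ` \<P> = {1..n} - {i \<in> {1..n}. a i \<noteq> 0}"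
    using cycle_path_partition_exists[of "{1..n}" \<pi> "{i \<in> {1..n}. a i \<noteq> 0}"] by blast
  note fin = cycle_path_partitionD(1,2)[OF P] and CP = cycle_path_partitionD(3)[OF P]
    and lists = cycle_path_partitionD(4)[OF P] and closed = cycle_path_partitionD(7)[OF P]
  obtain Cs where Cs: "set Cs = \<C>" "distinct Cs"
    using finite_distinct_list[OF fin(1)] by blast
  obtain Ps where Ps: "set Ps = \<P>" "distinct Ps"
    using finite_distinct_list[OF fin(2)] by blast
  let ?B = "Cs @ Ps"
  let ?g = "\<lambda>xs j. xs ! (j - 1)"
  define \<beta> where "\<beta> xs j = (if a (?g xs j) = 0 then 0 else 1 :: complex)" for xs j
  have bij: "bij_betw (\<lambda>(xs, j). ?g xs j) (SIGMA xs:\<C> \<union> \<P>. {1..length xs}) {1..n}"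
    by (rule bij_betw_cycle_path_partition[OF P])
  \<comment> \<open>The vertices of weight \<open>0\<close> are exactly the ends of the paths, so each block has the weights of
    \<open>E\<close> or of \<open>EN\<close> after rescaling.\<close>
  have zero_iff: "a (?g xs j) = 0 \<longleftrightarrow> xs \<in> \<P> \<and> j = length xs"
    if xs: "xs \<in> \<C> \<union> \<P>" and j: "j \<in> {1..length xs}" for xs j
  proof -
    have last: "last ys = ?g ys (length ys)" "length ys \<in> {1..length ys}" if "ys \<in> \<P>" for ys
      using lists[of ys] that by (auto simp: last_conv_nth Suc_le_eq)
    have "?g xs j \<in> {1..n}" using bij_betwE[OF bij] xs j by auto
    then have "a (?g xs j) = 0 \<longleftrightarrow> ?g xs j \<in> last ` \<P>" unfolding lst by auto
    also have "\<dots> \<longleftrightarrow> (\<exists>ys\<in>\<P>. ?g xs j = ?g ys (length ys))"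
      using last by force
    also have "\<dots> \<longleftrightarrow> xs \<in> \<P> \<and> j = length xs"
      using inj_onD[OF bij_betw_imp_inj_on[OF bij], of "(xs, j)" "(ys, length ys)" for ys]
        xs j last(2) by fastforce
    finally show ?thesis .
  qed
  have "\<forall>xs\<in>\<C> \<union> \<P>. \<exists>w. (\<forall>j. w j \<noteq> 0) \<and>
      (\<forall>j\<in>{1..length xs}. w (rot (length xs) j) * a (?g xs j) = \<beta> xs j * (w j)\<^sup>2)"
  proof
    fix xs assume "xs \<in> \<C> \<union> \<P>"
    then have len: "length xs \<ge> 1" using lists[of xs] by (simp add: Suc_le_eq)
    \<comment> \<open>The weight \<open>0\<close> at the end of a path is replaced by \<open>1\<close> for the recursion; both sides of the
      required equation vanish there.\<close>
    define \<alpha> where "\<alpha> j = (if a (?g xs j) = 0 then 1 else a (?g xs j))" for j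
    have "\<alpha> j \<noteq> 0" for j by (simp add: \<alpha>_def)
    from cyclic_rescaling_exists[of \<alpha>, OF this len] obtain w where "\<forall>j. w j \<noteq> 0"
      and w: "\<forall>j\<in>{1..length xs}. w (rot (length xs) j) * \<alpha> j = (w j)\<^sup>2" by blast
    moreover have "w (rot (length xs) j) * a (?g xs j) = \<beta> xs j * (w j)\<^sup>2"
      if "j \<in> {1..length xs}" for j
      using bspec[OF w that] by (auto simp: \<alpha>_def \<beta>_def split: if_splits)
    ultimately show "\<exists>w. (\<forall>j. w j \<noteq> 0) \<and>
      (\<forall>j\<in>{1..length xs}. w (rot (length xs) j) * a (?g xs j) = \<beta> xs j * (w j)\<^sup>2)" by blast
  qed
  then obtain W where W: "\<And>xs j. xs \<in> \<C> \<union> \<P> \<Longrightarrow> W xs j \<noteq> 0"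
    "\<And>xs j. xs \<in> \<C> \<union> \<P> \<Longrightarrow> j \<in> {1..length xs} \<Longrightarrow>
       W xs (rot (length xs) j) * a (?g xs j) = \<beta> xs j * (W xs j)\<^sup>2"
    by (metis (no_types, lifting) bchoice)
  have arrow: "?g xs (rot (length xs) j) = \<pi> (?g xs j)"
    if xs: "xs \<in> \<C> \<union> \<P>" and j: "j \<in> {1..length xs}" and nz: "a (?g xs j) \<noteq> 0" for xs j
  proof (cases "j < length xs")
    case True
    then have "Suc (j - 1) < length xs" using j by simp
    then have "xs ! Suc (j - 1) = \<pi> (xs ! (j - 1))"
      using lists[OF xs] by (simp add: successively_conv_nth)
    then show ?thesis using True j by (simp add: rot_def)
  next
    case False
    then have "xs \<in> \<C>" "j = length xs" using zero_iff[OF xs j] nz xs j by auto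
    then show ?thesis
      using closed[of xs] lists[OF xs] by (simp add: rot_def last_conv_nth hd_conv_nth)
  qed
  have "alg_isomorphic (perm_evolution_alg n \<pi> a)
    (direct_sum_alg (map (\<lambda>xs. perm_evolution_alg (length xs) (rot (length xs)) (\<beta> xs)) ?B))"
  proof (rule alg_isomorphic_direct_sum_blocks[where g = ?g and
        d = "\<lambda>xs j. if xs \<in> \<C> \<union> \<P> then W xs j else 1"])
    show "distinct ?B" using Cs Ps CP by auto
    show "bij_betw (\<lambda>(xs, j). ?g xs j) (SIGMA xs:set ?B. {1..length xs}) {1..n}"
      using bij Cs Ps by simp
  qed (use \<pi> bij_betw_rot W arrow Cs Ps in auto)
  moreover have "map (\<lambda>xs. perm_evolution_alg (length xs) (rot (length xs)) (\<beta> xs)) ?B =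
      map E_alg (map length Cs) @ map EN_alg (map length Ps)"
  proof -
    have "perm_evolution_alg (length xs) (rot (length xs)) (\<beta> xs) = E_alg (length xs)"
      if "xs \<in> \<C>" for xs
      unfolding E_alg_eq using zero_iff[of xs] that CP
      by (intro perm_evolution_alg_cong) (auto simp: \<beta>_def)
    moreover have "perm_evolution_alg (length xs) (rot (length xs)) (\<beta> xs) = EN_alg (length xs)"
      if "xs \<in> \<P>" for xs
      unfolding EN_alg_eq using zero_iff[of xs] that
      by (intro perm_evolution_alg_cong) (auto simp: \<beta>_def)
    ultimately show ?thesis using Cs Ps by simp
  qed
  moreover have "\<forall>p\<in>set (map length Cs). p \<ge> 1" "\<forall>k\<in>set (map length Ps). k \<ge> 1"
    using lists Cs Ps by (auto simp: Suc_le_eq)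
  ultimately show ?thesis by metis
qed

end
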